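(* Let $m \geq 2$ be an integer and let $G$ be a finite group with centre $Z(G)$ such that $\frac{G}{Z(G)} \cong D_{2m}$. Then the Laplacian spectrum of the non-commuting graph $\mathcal{A}_G$ of $G$ is $$\{0, (m|Z(G)|)^{(m-1)|Z(G)|-1}, (2(m-1)|Z(G)|)^{m|Z(G)|-m}, ((2m-1)|Z(G)|)^m\}.$$
   Context: $D_{2m} = \langle a, b : a^m = b^2 = 1, bab^{-1} = a^{-1}\rangle$ is the dihedral group of order $2m$ (for $m=2$ it is $\mathbb{Z}_2\times\mathbb{Z}_2$). For a finite non-abelian group $G$, the non-commuting graph $\mathcal{A}_G$ is the simple undirected graph with vertex set $G \setminus Z(G)$ in which two vertices $x,y$ are adjacent if and only if $xy \neq yx$. The Laplacian matrix of a finite graph is $D - A$, with $D$ the degree matrix and $A$ the adjacency matrix. The Laplacian spectrum is the multiset of eigenvalues of the Laplacian matrix; $\{\dots,\alpha^{a},\dots\}$ means the eigenvalue $\alpha$ is listed $a$ times (no exponent means once, exponent $0$ means the entry is absent, and if listed values coincide their multiplicities add). *)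

theory Defs
  imports
    "HOL-Algebra.Coset"
    "Jordan_Normal_Form.Char_Poly"
    "Graph_Theory.Pair_Digraph"
begin

section \<open>Groups given by generators and relations\<close>

text \<open>
  A word is a list of letters; the letter \<open>(g, True)\<close> stands for the generator \<open>g\<close> and
  \<open>(g, False)\<close> for its formal inverse. The set \<open>R\<close> lists the defining relations \<open>u = v\<close>.
\<close>

type_synonym 'g word = "('g \<times> bool) list"

inductive word_eq :: "('g word \<times> 'g word) set \<Rightarrow> 'g word \<Rightarrow> 'g word \<Rightarrow> bool"
  for R :: "('g word \<times> 'g word) set" where
  refl: "word_eq R u u"
| sym: "word_eq R u v \<Longrightarrow> word_eq R v u"
| trans: "word_eq R u v \<Longrightarrow> word_eq R v w \<Longrightarrow> word_eq R u w"
| append: "word_eq R u u' \<Longrightarrow> word_eq R v v' \<Longrightarrow> word_eq R (u @ v) (u' @ v')"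
| cancel: "word_eq R [(g, e), (g, \<not> e)] []"
| relation: "(u, v) \<in> R \<Longrightarrow> word_eq R u v"

definition word_rel :: "('g word \<times> 'g word) set \<Rightarrow> ('g word \<times> 'g word) set" where
  "word_rel R = {(u, v). word_eq R u v}"

text \<open>The group with one generator for each element of the type \<open>'g\<close> and relations \<open>R\<close>.\<close>

definition presented_group :: "('g word \<times> 'g word) set \<Rightarrow> 'g word set monoid" where
  "presented_group R =
    \<lparr>carrier = UNIV // word_rel R,
     monoid.mult = (\<lambda>X Y. \<Union>u\<in>X. \<Union>v\<in>Y. word_rel R `` {u @ v}),
     one = word_rel R `` {[]}\<rparr>"

lemma equiv_word_rel: "equiv UNIV (word_rel R)"
  unfolding word_rel_def
  by (rule equivI) (auto simp: refl_on_def sym_def trans_def intro: word_eq.intros)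

lemma word_class_eq_iff: "word_rel R `` {u} = word_rel R `` {v} \<longleftrightarrow> word_eq R u v"
  using eq_equiv_class_iff[OF equiv_word_rel, of u v R] by (auto simp: word_rel_def)

lemma carrier_presented_group: "carrier (presented_group R) = range (\<lambda>u. word_rel R `` {u})"
  by (auto simp: presented_group_def quotient_def)

lemma mult_presented_group:
  "word_rel R `` {u} \<otimes>\<^bsub>presented_group R\<^esub> word_rel R `` {v} = word_rel R `` {u @ v}"
proof -
  have "(\<lambda>u v. word_rel R `` {u @ v}) respects2 word_rel R"
    by (auto simp: congruent2_def word_class_eq_iff)
       (auto simp: word_rel_def intro: word_eq.append)
  from UN_equiv_class2[OF equiv_word_rel equiv_word_rel this]
  show ?thesis by (simp add: presented_group_def)
qed

lemma word_eq_inverse: "word_eq R (rev (map (\<lambda>(g, e). (g, \<not> e)) u) @ u) []"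
proof (induction u)
  case Nil
  show ?case by (simp add: word_eq.refl)
next
  case (Cons x u)
  obtain g e where x: "x = (g, e)" by (cases x)
  let ?i = "rev (map (\<lambda>(g, e). (g, \<not> e)) u)"
  have "word_eq R ([(g, \<not> e), (g, \<not> \<not> e)]) []" by (rule word_eq.cancel)
  hence "word_eq R (?i @ ([(g, \<not> e), (g, e)] @ u)) (?i @ ([] @ u))"
    by (intro word_eq.append word_eq.refl) simp
  with Cons.IH show ?case by (auto simp: x intro: word_eq.trans)
qed

lemma group_presented_group: "group (presented_group R)"
proof (rule groupI)
  fix X assume "X \<in> carrier (presented_group R)"
  then obtain u where u: "X = word_rel R `` {u}" by (auto simp: carrier_presented_group)
  let ?Y = "word_rel R `` {rev (map (\<lambda>(g, e). (g, \<not> e)) u)}"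
  have "?Y \<otimes>\<^bsub>presented_group R\<^esub> X = \<one>\<^bsub>presented_group R\<^esub>"
    unfolding u mult_presented_group
    by (simp add: presented_group_def word_class_eq_iff word_eq_inverse)
  thus "\<exists>Y\<in>carrier (presented_group R). Y \<otimes>\<^bsub>presented_group R\<^esub> X = \<one>\<^bsub>presented_group R\<^esub>"
    by (auto simp: carrier_presented_group)
next
  have one: "\<one>\<^bsub>presented_group R\<^esub> = word_rel R `` {[]}"
    by (simp add: presented_group_def)
  show "\<one>\<^bsub>presented_group R\<^esub> \<in> carrier (presented_group R)"
    by (auto simp: one carrier_presented_group)
  show "\<And>X. X \<in> carrier (presented_group R) \<Longrightarrow> \<one>\<^bsub>presented_group R\<^esub> \<otimes>\<^bsub>presented_group R\<^esub> X = X"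
    by (auto simp: one carrier_presented_group mult_presented_group)
qed (auto simp: carrier_presented_group mult_presented_group)


section \<open>Dihedral groups\<close>

datatype dihedral_gen = Gen_a | Gen_b

definition dihedral_relations :: "nat \<Rightarrow> (dihedral_gen word \<times> dihedral_gen word) set" where
  "dihedral_relations m =
    {(replicate m (Gen_a, True), []),
     (replicate 2 (Gen_b, True), []),
     ([(Gen_b, True), (Gen_a, True), (Gen_b, False)], [(Gen_a, False)])}"

text \<open>The parameter is \<open>m\<close>, so this is the dihedral group of order \<open>2 * m\<close>.\<close>

definition dihedral_group :: "nat \<Rightarrow> dihedral_gen word set monoid" where
  "dihedral_group m = presented_group (dihedral_relations m)"

lemma group_dihedral_group: "group (dihedral_group m)"
  by (simp add: dihedral_group_def group_presented_group)

text \<open>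
  To see that the presentation does not collapse, let words act by left multiplication on
  pairs \<open>(k, s)\<close>, which stand for \<open>a\<^sup>k\<close> (if \<open>s\<close> is false) and \<open>a\<^sup>k b\<close> (if \<open>s\<close> is true).
\<close>

fun dihedral_step :: "dihedral_gen \<times> bool \<Rightarrow> int \<times> bool \<Rightarrow> int \<times> bool" where
  "dihedral_step (Gen_a, e) (k, s) = (if e then k + 1 else k - 1, s)"
| "dihedral_step (Gen_b, e) (k, s) = (- k, \<not> s)"

definition dihedral_cong :: "nat \<Rightarrow> int \<times> bool \<Rightarrow> int \<times> bool \<Rightarrow> bool" where
  "dihedral_cong m p q \<longleftrightarrow> int m dvd fst p - fst q \<and> snd p = snd q"

lemma dihedral_cong_refl: "dihedral_cong m p p"
  by (simp add: dihedral_cong_def)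

lemma dihedral_cong_sym: "dihedral_cong m p q \<Longrightarrow> dihedral_cong m q p"
  by (simp add: dihedral_cong_def dvd_diff_commute)

lemma dihedral_cong_trans: "dihedral_cong m p q \<Longrightarrow> dihedral_cong m q r \<Longrightarrow> dihedral_cong m p r"
  unfolding dihedral_cong_def using dvd_add[of "int m" "fst p - fst q" "fst q - fst r"] by auto

lemma dihedral_cong_step:
  assumes "dihedral_cong m p q"
  shows "dihedral_cong m (dihedral_step x p) (dihedral_step x q)"
proof -
  obtain k s l t where pq: "p = (k, s)" "q = (l, t)" by (cases p, cases q)
  obtain g e where x: "x = (g, e)" by (cases x)
  show ?thesis
    using assms dvd_diff_commute[of "int m" k l]
    by (cases g) (auto simp: dihedral_cong_def pq x)
qed

lemma dihedral_cong_foldr: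
  "dihedral_cong m p q \<Longrightarrow> dihedral_cong m (foldr dihedral_step w p) (foldr dihedral_step w q)"
  by (induction w) (auto intro: dihedral_cong_step)

lemma funpow_dihedral_step:
  "(dihedral_step (Gen_a, True) ^^ n) (k, s) = (k + int n, s)"
  by (induction n) auto

lemma dihedral_act_word_eq:
  assumes "word_eq (dihedral_relations m) u v"
  shows "dihedral_cong m (foldr dihedral_step u p) (foldr dihedral_step v p)"
  using assms
proof (induction arbitrary: p rule: word_eq.induct)
  case (refl u)
  show ?case by (rule dihedral_cong_refl)
next
  case (sym u v)
  thus ?case by (blast intro: dihedral_cong_sym)
next
  case (trans u v w)
  thus ?case by (blast intro: dihedral_cong_trans)
next
  case (append u u' v v')
  show ?case
    using dihedral_cong_trans[OF append.IH(1) dihedral_cong_foldr[OF append.IH(2)]] by simp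
next
  case (cancel g e)
  show ?case by (cases g; cases p) (auto simp: dihedral_cong_def)
next
  case (relation u v)
  thus ?case
    by (cases p) (auto simp: dihedral_relations_def dihedral_cong_def funpow_dihedral_step
        numeral_2_eq_2)
qed

definition dihedral_nf :: "nat \<times> bool \<Rightarrow> dihedral_gen word" where
  "dihedral_nf = (\<lambda>(k, s). replicate k (Gen_a, True) @ (if s then [(Gen_b, True)] else []))"

lemma dihedral_cong_nf:
  assumes "k < m" "l < m"
    and "word_eq (dihedral_relations m) (dihedral_nf (k, s)) (dihedral_nf (l, t))"
  shows "k = l \<and> s = t"
proof -
  have act: "foldr dihedral_step (dihedral_nf (i, r)) (0, False) = (int i, r)" for i r
    by (auto simp: dihedral_nf_def funpow_dihedral_step)
  have "int m dvd int k - int l" "s = t"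
    using dihedral_act_word_eq[OF assms(3), of "(0, False)"]
    by (auto simp: act dihedral_cong_def)
  moreover have "\<bar>int k - int l\<bar> < int m" using assms(1,2) by auto
  ultimately show ?thesis using dvd_imp_le_int[of "int k - int l" "int m"] by auto
qed

lemma dihedral_word_eq_nf:
  assumes "m > 0"
  shows "\<exists>k<m. \<exists>s. word_eq (dihedral_relations m) w (dihedral_nf (k, s))"
proof (induction w)
  case Nil
  have "word_eq (dihedral_relations m) [] (dihedral_nf (0, False))"
    by (simp add: dihedral_nf_def word_eq.refl)
  thus ?case using assms by blast
next
  case (Cons x w)
  let ?E = "word_eq (dihedral_relations m)"
  let ?a = "(Gen_a, True)" and ?a' = "(Gen_a, False)" and ?b = "(Gen_b, True)" and ?b' = "(Gen_b, False)"
  note [trans] = word_eq.trans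
  have cong: "?E (p @ u @ q) (p @ v @ q)" if "?E u v" for p u v q
    using that by (intro word_eq.append word_eq.refl)
  have rel: "?E (replicate m ?a) []" "?E [?b, ?b] []" "?E [?b, ?a, ?b'] [?a']"
    by (rule word_eq.relation; simp add: dihedral_relations_def numeral_2_eq_2)+
  from Cons.IH obtain k s where k: "k < m" and w: "?E w (dihedral_nf (k, s))" by blast
  define bs where "bs = (if s then [?b] else [])"
  have nf: "dihedral_nf (k, s) = replicate k ?a @ bs" by (simp add: dihedral_nf_def bs_def)
  have wx: "?E (x # w) ([x] @ replicate k ?a @ bs)"
    using cong[OF w, of "[x]" "[]"] by (simp add: nf)
  have a_inv: "?E [?a'] (replicate (m - 1) ?a)"
  proof -
    have "replicate m ?a = [?a] @ replicate (m - 1) ?a"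
      using assms by (cases m) auto
    hence "?E ([?a'] @ []) ([?a'] @ ([?a] @ replicate (m - 1) ?a))"
      using word_eq.append[OF word_eq.refl word_eq.sym[OF rel(1)], of "[?a']"] by simp
    also have "?E \<dots> ([] @ replicate (m - 1) ?a)"
      using cong[OF word_eq.cancel[of _ Gen_a False], of "[]" "replicate (m - 1) ?a"] by simp
    finally show ?thesis by simp
  qed
  have a_red: "\<exists>l<m. ?E (replicate n ?a) (replicate l ?a)" for n
  proof (induction n rule: less_induct)
    case (less n)
    show ?case
    proof (cases "n < m")
      case True
      thus ?thesis by (blast intro: word_eq.refl)
    next
      case False
      hence "replicate n ?a = replicate m ?a @ replicate (n - m) ?a"
        by (simp flip: replicate_add)
      hence "?E (replicate n ?a) (replicate (n - m) ?a)"
        using cong[OF rel(1), of "[]" "replicate (n - m) ?a"] by simp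
      moreover obtain l where "l < m" "?E (replicate (n - m) ?a) (replicate l ?a)"
        using less.IH[of "n - m"] False assms by auto
      ultimately show ?thesis by (blast intro: word_eq.trans)
    qed
  qed
  have fin: ?case if "?E (x # w) (replicate n ?a @ (if t then [?b] else []))" for n t
  proof -
    obtain l where l: "l < m" "?E (replicate n ?a) (replicate l ?a)" using a_red by blast
    note that
    also have "?E (replicate n ?a @ (if t then [?b] else [])) (dihedral_nf (l, t))"
      using cong[OF l(2), of "[]" "if t then [?b] else []"] by (simp add: dihedral_nf_def)
    finally have "?E (x # w) (dihedral_nf (l, t))" .
    thus ?thesis using l(1) by blast
  qed
  have b_inv: "?E [?b'] [?b]"
  proof -
    have "?E ([?b'] @ []) ([?b'] @ [?b, ?b])"
      using word_eq.append[OF word_eq.refl word_eq.sym[OF rel(2)], of "[?b']"] by simp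
    also have "?E \<dots> ([] @ [?b])"
      using cong[OF word_eq.cancel[of _ Gen_b False], of "[]" "[?b]"] by simp
    finally show ?thesis by simp
  qed
  have ba: "?E [?b, ?a] (replicate (m - 1) ?a @ [?b])"
  proof -
    have "?E ([?b, ?a] @ []) ([?b, ?a] @ [?b', ?b])"
      using word_eq.append[OF word_eq.refl word_eq.sym[OF word_eq.cancel[of _ Gen_b False]],
          of _ "[?b, ?a]"] by simp
    also have "?E \<dots> ([?a'] @ [?b])" using cong[OF rel(3), of "[]" "[?b]"] by simp
    also have "?E \<dots> (replicate (m - 1) ?a @ [?b])" using cong[OF a_inv, of "[]" "[?b]"] by simp
    finally show ?thesis by simp
  qed
  have bak: "?E ([?b] @ replicate n ?a) (replicate ((m - 1) * n) ?a @ [?b])" for n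
  proof (induction n)
    case 0
    show ?case by (simp add: word_eq.refl)
  next
    case (Suc n)
    have eq: "replicate (m - 1) ?a @ replicate ((m - 1) * n) ?a = replicate ((m - 1) * Suc n) ?a"
      by (simp only: mult_Suc_right replicate_add)
    have "?E ([?b, ?a] @ replicate n ?a) ((replicate (m - 1) ?a @ [?b]) @ replicate n ?a)"
      by (rule word_eq.append[OF ba word_eq.refl])
    moreover have "?E (replicate (m - 1) ?a @ ([?b] @ replicate n ?a))
        (replicate (m - 1) ?a @ (replicate ((m - 1) * n) ?a @ [?b]))"
      by (rule word_eq.append[OF word_eq.refl Suc.IH])
    ultimately have "?E ([?b, ?a] @ replicate n ?a)
        ((replicate (m - 1) ?a @ replicate ((m - 1) * n) ?a) @ [?b])"
      unfolding append_assoc by (rule word_eq.trans)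
    thus ?case unfolding eq by simp
  qed
  have case_b: ?case if "?E (x # w) ([?b] @ replicate k ?a @ bs)"
  proof -
    note that
    also have "?E ([?b] @ replicate k ?a @ bs) ((replicate ((m - 1) * k) ?a @ [?b]) @ bs)"
      using cong[OF bak, of "[]" k bs] by simp
    finally have *: "?E (x # w) ((replicate ((m - 1) * k) ?a @ [?b]) @ bs)" .
    show ?thesis
    proof (cases s)
      case True
      note *
      also have "?E ((replicate ((m - 1) * k) ?a @ [?b]) @ bs) (replicate ((m - 1) * k) ?a @ [])"
        using cong[OF rel(2), of "replicate ((m - 1) * k) ?a" "[]"] True by (simp add: bs_def)
      finally show ?thesis by (intro fin[of _ False]) simp
    next
      case False
      thus ?thesis using * by (intro fin[of _ True]) (simp add: bs_def)
    qed
  qed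
  obtain g e where x: "x = (g, e)" by (cases x)
  show ?case
  proof (cases g)
    case Gen_a
    show ?thesis
    proof (cases e)
      case True
      thus ?thesis using wx Gen_a x by (intro fin[of "Suc k" s]) (simp add: bs_def)
    next
      case False
      have "?E ([?a'] @ replicate k ?a @ bs) (replicate (m - 1) ?a @ replicate k ?a @ bs)"
        using cong[OF a_inv, of "[]" "replicate k ?a @ bs"] by simp
      with wx False Gen_a x have "?E (x # w) (replicate (m - 1) ?a @ replicate k ?a @ bs)"
        by (auto intro: word_eq.trans)
      thus ?thesis by (intro fin[of "m - 1 + k" s]) (simp add: bs_def replicate_add)
    qed
  next
    case Gen_b
    show ?thesis
    proof (cases e)
      case True
      thus ?thesis using wx Gen_b x by (intro case_b) simp
    next
      case False
      have "?E ([?b'] @ replicate k ?a @ bs) ([?b] @ replicate k ?a @ bs)"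
        using cong[OF b_inv, of "[]" "replicate k ?a @ bs"] by simp
      with wx False Gen_b x show ?thesis by (intro case_b) (auto intro: word_eq.trans)
    qed
  qed
qed

lemma order_dihedral_group:
  assumes "m > 0"
  shows "Coset.order (dihedral_group m) = 2 * m"
proof -
  let ?f = "\<lambda>p. word_rel (dihedral_relations m) `` {dihedral_nf p}"
  have "inj_on ?f ({..<m} \<times> UNIV)"
    by (auto simp: inj_on_def word_class_eq_iff dest: dihedral_cong_nf)
  moreover have "carrier (dihedral_group m) = ?f ` ({..<m} \<times> UNIV)"
  proof (intro equalityI subsetI)
    fix X assume "X \<in> carrier (dihedral_group m)"
    then obtain w where X: "X = word_rel (dihedral_relations m) `` {w}"
      by (auto simp: dihedral_group_def carrier_presented_group)
    obtain k s where "k < m" "word_eq (dihedral_relations m) w (dihedral_nf (k, s))"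
      using dihedral_word_eq_nf[OF assms, of w] by blast
    thus "X \<in> ?f ` ({..<m} \<times> UNIV)"
      by (auto simp: X word_class_eq_iff intro!: image_eqI[of _ _ "(k, s)"])
  qed (auto simp: dihedral_group_def carrier_presented_group)
  ultimately show ?thesis
    by (simp add: Coset.order_def card_image card_cartesian_product UNIV_bool)
qed


section \<open>The centre and the non-commuting graph\<close>

definition center :: "('a, 'b) monoid_scheme \<Rightarrow> 'a set" where
  "center G = {z \<in> carrier G. \<forall>x\<in>carrier G. z \<otimes>\<^bsub>G\<^esub> x = x \<otimes>\<^bsub>G\<^esub> z}"

lemma (in group) center_normal: "center G \<lhd> G"
proof (rule normal_invI)
  have closed: "z \<in> carrier G" if "z \<in> center G" for z
    using that by (simp add: center_def)
  have comm: "z \<otimes> x = x \<otimes> z" if "z \<in> center G" "x \<in> carrier G" for z x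
    using that by (simp add: center_def)
  have centerI: "z \<in> center G" if "z \<in> carrier G" "\<And>x. x \<in> carrier G \<Longrightarrow> z \<otimes> x = x \<otimes> z" for z
    using that by (simp add: center_def)
  show "subgroup (center G) G"
  proof (rule subgroupI)
    show "center G \<subseteq> carrier G" using closed by blast
    have "\<one> \<in> center G" by (rule centerI) auto
    thus "center G \<noteq> {}" by blast
  next
    fix a assume a: "a \<in> center G"
    show "inv a \<in> center G"
    proof (rule centerI)
      fix x assume x: "x \<in> carrier G"
      have "inv a \<otimes> x = inv a \<otimes> ((x \<otimes> a) \<otimes> inv a)"
        using x closed[OF a] by (simp add: m_assoc)
      also have "\<dots> = inv a \<otimes> ((a \<otimes> x) \<otimes> inv a)"
        by (simp only: comm[OF a x])
      also have "\<dots> = (inv a \<otimes> a) \<otimes> (x \<otimes> inv a)"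
        using x closed[OF a] by (simp only: m_assoc inv_closed m_closed)
      finally show "inv a \<otimes> x = x \<otimes> inv a" using x closed[OF a] by simp
    qed (use closed[OF a] in simp)
  next
    fix a b assume a: "a \<in> center G" and b: "b \<in> center G"
    show "a \<otimes> b \<in> center G"
    proof (rule centerI)
      fix x assume x: "x \<in> carrier G"
      have "a \<otimes> b \<otimes> x = a \<otimes> (b \<otimes> x)" using x closed[OF a] closed[OF b] by (simp add: m_assoc)
      also have "\<dots> = a \<otimes> (x \<otimes> b)" by (simp only: comm[OF b x])
      also have "\<dots> = (a \<otimes> x) \<otimes> b" using x closed[OF a] closed[OF b] by (simp add: m_assoc)
      also have "\<dots> = (x \<otimes> a) \<otimes> b" by (simp only: comm[OF a x])
      also have "\<dots> = x \<otimes> (a \<otimes> b)" using x closed[OF a] closed[OF b] by (simp add: m_assoc)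
      finally show "a \<otimes> b \<otimes> x = x \<otimes> (a \<otimes> b)" .
    qed (use closed[OF a] closed[OF b] in simp)
  qed
  fix x h assume x: "x \<in> carrier G" and h: "h \<in> center G"
  have "x \<otimes> h \<otimes> inv x = h \<otimes> x \<otimes> inv x" by (simp only: comm[OF h x])
  also have "\<dots> = h" using x closed[OF h] by (simp add: m_assoc)
  finally show "x \<otimes> h \<otimes> inv x \<in> center G" using h by simp
qed

text \<open>As usual in \<^theory>\<open>Graph_Theory.Pair_Digraph\<close>, each undirected edge is a pair of opposite arcs.\<close>

definition non_commuting_graph :: "('a, 'b) monoid_scheme \<Rightarrow> 'a pair_pre_digraph" where
  "non_commuting_graph G =
    \<lparr>pverts = carrier G - center G,
     parcs = {(x, y). x \<in> carrier G - center G \<and> y \<in> carrier G - center G \<and>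
                      x \<otimes>\<^bsub>G\<^esub> y \<noteq> y \<otimes>\<^bsub>G\<^esub> x}\<rparr>"

lemma pair_graph_non_commuting_graph:
  assumes "finite (carrier G)"
  shows "pair_graph (non_commuting_graph G)"
proof
  have "parcs (non_commuting_graph G) \<subseteq> carrier G \<times> carrier G"
    by (auto simp: non_commuting_graph_def)
  thus "finite (parcs (non_commuting_graph G))"
    using assms by (meson finite_SigmaI finite_subset)
  show "symmetric (with_proj (non_commuting_graph G))"
    by (auto simp: symmetric_def non_commuting_graph_def sym_def)
qed (use assms in \<open>auto simp: non_commuting_graph_def\<close>)


section \<open>Laplacian matrix and Laplacian spectrum\<close>

text \<open>
  Matrices are indexed by natural numbers, so these definitions take an enumeration \<open>vs\<close> of the
  vertices, without repetition; row and column \<open>i\<close> belong to the vertex \<open>vs ! i\<close>. The graph is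
  meant to be symmetric, so that the out-degree is the degree.
\<close>

definition degree_matrix :: "'a pair_pre_digraph \<Rightarrow> 'a list \<Rightarrow> complex mat" where
  "degree_matrix \<Gamma> vs = mat (length vs) (length vs)
    (\<lambda>(i, j). if i = j then of_nat (out_degree (with_proj \<Gamma>) (vs ! i)) else 0)"

definition adjacency_matrix :: "'a pair_pre_digraph \<Rightarrow> 'a list \<Rightarrow> complex mat" where
  "adjacency_matrix \<Gamma> vs = mat (length vs) (length vs)
    (\<lambda>(i, j). if (vs ! i, vs ! j) \<in> parcs \<Gamma> then 1 else 0)"

definition laplacian_matrix :: "'a pair_pre_digraph \<Rightarrow> 'a list \<Rightarrow> complex mat" where
  "laplacian_matrix \<Gamma> vs = degree_matrix \<Gamma> vs - adjacency_matrix \<Gamma> vs"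

text \<open>The eigenvalues with their algebraic multiplicities.\<close>

definition laplacian_spectrum :: "'a pair_pre_digraph \<Rightarrow> 'a list \<Rightarrow> complex multiset" where
  "laplacian_spectrum \<Gamma> vs = proots (char_poly (laplacian_matrix \<Gamma> vs))"

end

theory Submission
  imports Defs "HOL-Library.Disjoint_Sets"
begin

text \<open>
  Let \<open>A\<close> be the preimage in \<open>G\<close> of the rotation subgroup of the dihedral quotient. It is abelian,
  being generated by the centre and one further element, and \<open>G\<close> is the union of \<open>A\<close> and one more
  coset of \<open>A\<close>. Hence on the non-central elements commuting is an equivalence relation: its
  classes are \<open>A - Z(G)\<close> and the cosets of \<open>Z(G)\<close> outside \<open>A\<close>. So the non-commuting graph is
  complete multipartite, with one part of size \<open>(m - 1) * card Z(G)\<close> and \<open>m\<close> parts of size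
  \<open>card Z(G)\<close>, and the Laplacian of a complete multipartite graph becomes triangular in a basis
  built from the indicator vectors of the parts.
\<close>

section \<open>Matrices indexed by lists of distinct vertices\<close>

text \<open>Indexing by vertices instead of positions turns products over a distinct list into sums
  over its set, where the order of the vertices no longer matters.\<close>

definition matrix_of :: "('a \<Rightarrow> 'a \<Rightarrow> 'c) \<Rightarrow> 'a list \<Rightarrow> 'a list \<Rightarrow> 'c mat" where
  "matrix_of f xs ys = mat (length xs) (length ys) (\<lambda>(i, j). f (xs ! i) (ys ! j))"

lemma matrix_of_carrier [simp]: "matrix_of f xs ys \<in> carrier_mat (length xs) (length ys)"
  by (simp add: matrix_of_def)

lemma matrix_of_cong:
  assumes "\<And>x y. x \<in> set xs \<Longrightarrow> y \<in> set ys \<Longrightarrow> f x y = g x y"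
  shows "matrix_of f xs ys = matrix_of g xs ys"
  using assms by (auto simp: matrix_of_def intro!: cong_mat)

lemma matrix_of_mult:
  fixes f g :: "'a \<Rightarrow> 'a \<Rightarrow> 'c :: semiring_0"
  assumes "distinct ys"
  shows "matrix_of f xs ys * matrix_of g ys zs =
    matrix_of (\<lambda>x z. \<Sum>y\<in>set ys. f x y * g y z) xs zs"
proof -
  have "(\<Sum>k = 0..<length ys. h (ys ! k)) = sum h (set ys)" for h :: "'a \<Rightarrow> 'c"
    using sum.reindex_bij_betw[OF bij_betw_nth[OF assms HOL.refl HOL.refl], of h]
    by (simp add: atLeast0LessThan)
  thus ?thesis
    by (intro eq_matI) (auto simp: matrix_of_def scalar_prod_def)
qed

lemma matrix_of_one:
  assumes "distinct xs"
  shows "matrix_of (\<lambda>x y. if x = y then 1 else 0) xs xs = 1\<^sub>m (length xs)"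
  using assms by (intro eq_matI) (auto simp: matrix_of_def nth_eq_iff_index_eq)

lemma matrix_of_delta_mult:
  fixes g :: "'a \<Rightarrow> 'a \<Rightarrow> 'c :: semiring_1"
  assumes "distinct ys" "set xs \<subseteq> set ys"
  shows "matrix_of (\<lambda>x y. if x = y then 1 else 0) xs ys * matrix_of g ys zs = matrix_of g xs zs"
  using assms
  by (auto simp: matrix_of_mult if_distrib[of "\<lambda>z. z * _"] cong: if_cong intro!: matrix_of_cong)

text \<open>Conjugation by the permutation matrix between the two enumerations. It allows a
  characteristic polynomial to be computed in any convenient vertex order.\<close>

lemma similar_matrix_of_permute:
  fixes f :: "'a \<Rightarrow> 'a \<Rightarrow> 'c :: semiring_1"
  assumes "distinct xs" "distinct ys" "set xs = set ys"
  shows "similar_mat (matrix_of f xs xs) (matrix_of f ys ys)"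
proof (rule similar_matI)
  let ?P = "matrix_of (\<lambda>x y. if x = y then 1 else 0) xs ys :: 'c mat"
  let ?Q = "matrix_of (\<lambda>x y. if x = y then 1 else 0) ys xs :: 'c mat"
  have len: "length ys = length xs"
    using assms by (metis distinct_card)
  show "{matrix_of f xs xs, matrix_of f ys ys, ?P, ?Q} \<subseteq> carrier_mat (length xs) (length xs)"
    by (auto simp: matrix_of_def len)
  have "matrix_of f xs ys * ?Q = matrix_of f xs xs"
    using assms
    by (auto simp: matrix_of_mult if_distrib[of "(*) _"] cong: if_cong intro!: matrix_of_cong)
  thus "?P * ?Q = 1\<^sub>m (length xs)" "?Q * ?P = 1\<^sub>m (length xs)"
    "matrix_of f xs xs = ?P * matrix_of f ys ys * ?Q"
    using assms len by (simp_all add: matrix_of_delta_mult matrix_of_one)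
qed

section \<open>Eigenvalues read off after a triangularizing change of basis\<close>

lemma proots_prod_linear: "proots (\<Prod>a\<leftarrow>as. [:- a, 1:]) = mset (as :: 'c :: idom list)"
proof (induction as)
  case (Cons a as)
  have "(\<Prod>a\<leftarrow>as. [:- a, 1:]) \<noteq> 0" by (auto simp: prod_list_zero_iff)
  thus ?case using Cons by (simp add: proots_mult del: mult_pCons_left)
qed simp

text \<open>
  The rank function orders the vertices so that the change of basis \<open>P\<close> is lower triangular
  and the matrix \<open>B\<close> of the operator in the new basis is upper triangular.
\<close>

lemma proots_char_poly_triangular:
  fixes L P B :: "'a \<Rightarrow> 'a \<Rightarrow> 'c :: field" and rank :: "'a \<Rightarrow> nat"
  assumes "distinct vs"
    and P1: "\<And>x. x \<in> set vs \<Longrightarrow> P x x = 1"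
    and P: "\<And>x y. \<lbrakk>x \<in> set vs; y \<in> set vs; x \<noteq> y; P x y \<noteq> 0\<rbrakk> \<Longrightarrow> rank y < rank x"
    and B: "\<And>x y. \<lbrakk>x \<in> set vs; y \<in> set vs; x \<noteq> y; B x y \<noteq> 0\<rbrakk> \<Longrightarrow> rank x < rank y"
    and LP: "\<And>x y. \<lbrakk>x \<in> set vs; y \<in> set vs\<rbrakk> \<Longrightarrow>
      (\<Sum>w\<in>set vs. L x w * P w y) = (\<Sum>w\<in>set vs. P x w * B w y)"
  shows "proots (char_poly (matrix_of L vs vs)) = image_mset (\<lambda>x. B x x) (mset vs)"
proof -
  \<comment> \<open>Nonzero off-diagonal entries of \<open>P\<close> and \<open>B\<close> force a
    strict inequality of ranks, so any order among vertices of equal rank gives triangular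
    matrices.\<close>
  define ws where "ws = sort_key rank vs"
  define n where "n = length ws"
  have ws: "distinct ws" "set ws = set vs" "mset ws = mset vs"
    using \<open>distinct vs\<close> by (auto simp: ws_def)
  let ?L = "matrix_of L ws ws" and ?P = "matrix_of P ws ws" and ?B = "matrix_of B ws ws"
  have dims: "?L \<in> carrier_mat n n" "?P \<in> carrier_mat n n" "?B \<in> carrier_mat n n"
    by (simp_all add: n_def)
  have sorted: "rank (ws ! i) \<le> rank (ws ! j)" if "i \<le> j" "j < n" for i j
    using sorted_nth_mono[of "map rank ws" i j] that by (simp add: ws_def n_def)
  have neq: "ws ! i \<noteq> ws ! j" if "i < j" "j < n" for i j
    using that ws(1) by (simp add: nth_eq_iff_index_eq n_def)
  have in_vs: "ws ! i \<in> set vs" if "i < n" for i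
    using that ws(2) nth_mem[of i ws] by (simp add: n_def)
  have det: "det ?P = prod_list (diag_mat ?P)"
  proof (rule det_lower_triangular[OF _ dims(2)])
    fix i j assume ij: "i < j" "j < n"
    show "?P $$ (i, j) = 0"
      using ij sorted[of i j] P[of "ws ! i" "ws ! j"] neq[of i j] in_vs[of i] in_vs[of j]
      by (force simp: matrix_of_def n_def)
  qed
  \<comment> \<open>\<open>?P\<close> is unitriangular, hence invertible; this makes the
    intertwining relation \<open>LP\<close> a similarity between \<open>?L\<close> and
    \<open>?B\<close>.\<close>
  have "diag_mat ?P = replicate n 1"
    using P1 in_vs by (intro nth_equalityI) (auto simp: diag_mat_def matrix_of_def n_def)
  hence "det ?P \<noteq> 0" by (simp add: det)
  then obtain Q where Q: "Q \<in> carrier_mat n n" "Q * ?P = 1\<^sub>m n" "?P * Q = 1\<^sub>m n"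
    using det_non_zero_imp_unit[OF dims(2), of undefined] dims(2)
    by (auto simp: Units_def ring_mat_def)
  have LPB: "?L * ?P = ?P * ?B"
    using ws LP by (simp add: matrix_of_mult) (intro matrix_of_cong, auto)
  have "?L = ?L * (?P * Q)" using Q dims by simp
  also have "\<dots> = ?P * ?B * Q" using Q dims by (simp flip: LPB)
  finally have "similar_mat ?L ?B"
    using Q dims by (intro similar_matI[of _ _ ?P Q n]) auto
  moreover have "similar_mat (matrix_of L vs vs) ?L"
    using ws \<open>distinct vs\<close> by (intro similar_matrix_of_permute) auto
  ultimately have "char_poly (matrix_of L vs vs) = char_poly ?B"
    by (metis char_poly_similar)
  also have "\<dots> = (\<Prod>a\<leftarrow>diag_mat ?B. [:- a, 1:])"
  proof (rule char_poly_upper_triangular[OF dims(3)])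
    show "upper_triangular ?B"
      unfolding upper_triangular_def
    proof (intro allI impI)
      fix i j assume "i < dim_row ?B" "j < i"
      hence ij: "j < i" "i < n" by (simp_all add: matrix_of_def n_def)
      show "?B $$ (i, j) = 0"
        using ij sorted[of j i] B[of "ws ! i" "ws ! j"] neq[of j i] in_vs[of i] in_vs[of j]
        by (force simp: matrix_of_def n_def)
    qed
  qed
  also have "diag_mat ?B = map (\<lambda>x. B x x) ws"
    by (intro nth_equalityI) (auto simp: diag_mat_def matrix_of_def)
  finally show ?thesis by (simp only: proots_prod_linear mset_map ws)
qed

section \<open>Complete multipartite graphs\<close>

text \<open>The arcs leaving \<open>x\<close> correspond to their heads, all of which are vertices,
  so the out-degree becomes a count inside \<open>set vs\<close>.\<close>

lemma laplacian_matrix_eq_matrix_of: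
  assumes "distinct vs" "set vs = pverts \<Gamma>" "parcs \<Gamma> \<subseteq> pverts \<Gamma> \<times> pverts \<Gamma>"
  shows "laplacian_matrix \<Gamma> vs =
    matrix_of (\<lambda>x y. (if x = y then of_nat (card {w \<in> set vs. (x, w) \<in> parcs \<Gamma>}) else 0)
      - (if (x, y) \<in> parcs \<Gamma> then 1 else 0)) vs vs"
proof -
  have deg: "out_degree (with_proj \<Gamma>) x = card {w \<in> set vs. (x, w) \<in> parcs \<Gamma>}" for x
  proof -
    have "out_arcs (with_proj \<Gamma>) x = Pair x ` {w \<in> set vs. (x, w) \<in> parcs \<Gamma>}"
      using assms(2,3) by (auto simp: out_arcs_def)
    thus ?thesis by (simp add: out_degree_def card_image inj_on_def)
  qed
  show ?thesis
    using assms(1)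
    by (intro eq_matI)
       (auto simp: laplacian_matrix_def degree_matrix_def adjacency_matrix_def matrix_of_def deg
         nth_eq_iff_index_eq)
qed

text \<open>
  The part of a vertex \<open>x\<close> is encoded by its representative \<open>r x\<close>. The triangularizing basis
  consists of the all-ones vector (at \<open>r0\<close>), the indicators of the other parts (at their
  representatives) and the unit vectors of the remaining vertices.
\<close>

lemma laplacian_spectrum_representatives:
  fixes \<Gamma> :: "'a pair_pre_digraph" and r :: "'a \<Rightarrow> 'a"
  assumes "distinct vs" and V: "set vs = pverts \<Gamma>" and "parcs \<Gamma> \<subseteq> pverts \<Gamma> \<times> pverts \<Gamma>"
    and adj: "\<And>x y. \<lbrakk>x \<in> set vs; y \<in> set vs\<rbrakk> \<Longrightarrow> (x, y) \<in> parcs \<Gamma> \<longleftrightarrow> r x \<noteq> r y"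
    and rV: "\<And>x. x \<in> set vs \<Longrightarrow> r x \<in> set vs"
    and rr: "\<And>x. x \<in> set vs \<Longrightarrow> r (r x) = r x"
    and r0: "r0 \<in> set vs" "r r0 = r0"
  shows "laplacian_spectrum \<Gamma> vs =
    image_mset (\<lambda>x. if x = r0 then 0 else if r x = x then of_nat (length vs)
      else of_nat (length vs) - of_nat (card {w \<in> set vs. r w = r x})) (mset vs)"
proof -
  define n :: complex where "n = of_nat (length vs)"
  define p :: "'a \<Rightarrow> complex" where "p x = of_nat (card {w \<in> set vs. r w = r x})" for x
  \<comment> \<open>Here \<open>p x\<close> is the size of the part of \<open>x\<close> and
    \<open>n - p x\<close> its degree. \<open>L\<close> is the degree matrix minus the all-ones
    matrix plus the indicator of lying in the same part.\<close>
  define L :: "'a \<Rightarrow> 'a \<Rightarrow> complex" where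
    "L x y = (if x = y then n - p x else 0) - 1 + (if r y = r x then 1 else 0)" for x y
  define P :: "'a \<Rightarrow> 'a \<Rightarrow> complex" where
    "P x y = (if y = r0 then 1 else if r y = y then if r x = y then 1 else 0
      else if x = y then 1 else 0)" for x y
  \<comment> \<open>Column \<open>y\<close> holds the coordinates of \<open>L\<close> applied to the
    basis vector at \<open>y\<close>. \<open>L\<close> kills the all-ones vector, maps the indicator
    of the part of \<open>y\<close> to \<open>n\<close> times itself minus \<open>p y\<close> times
    the all-ones vector, and maps the unit vector at \<open>y\<close> to \<open>n - p y\<close>
    times itself, minus the all-ones vector, plus the indicator of its part. The indicator of the
    part of \<open>r0\<close> is not in the basis: it is the all-ones vector minus the other
    indicators, whence the entries \<open>- 1\<close> at all other representatives.\<close>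
  define B :: "'a \<Rightarrow> 'a \<Rightarrow> complex" where
    "B x y = (if y = r0 then 0
      else if r y = y then (if x = y then n else if x = r0 then - p y else 0)
      else if x = y then n - p y
      else if r y = r0 then (if r x = x \<and> x \<noteq> r0 then - 1 else 0)
      else if x = r0 then - 1 else if x = r y then 1 else 0)" for x y
  \<comment> \<open>The levels are the all-ones vector, the part indicators and the unit vectors.
    \<open>L\<close> sends a basis vector to a multiple of itself plus vectors of strictly lower
    level.\<close>
  define rank :: "'a \<Rightarrow> nat" where "rank x = (if x = r0 then 0 else if r x = x then 1 else 2)" for x
  have len: "length vs = card (set vs)"
    using \<open>distinct vs\<close> by (simp add: distinct_card)
  have sum_ind: "(\<Sum>w\<in>set vs. if Q w then c else 0) = c * of_nat (card {w \<in> set vs. Q w})"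
    for Q and c :: complex
    by (simp add: sum.If_cases Int_def)
  \<comment> \<open>Row \<open>x\<close> of \<open>P\<close> is supported on \<open>r0\<close>,
    \<open>r x\<close> and \<open>x\<close>; the conditionals keep coinciding vertices from being
    counted twice.\<close>
  have sum_P: "(\<Sum>w\<in>set vs. P x w * g w) =
      g r0 + (if r x = r0 then 0 else g (r x)) + (if r x = x then 0 else g x)"
    if x: "x \<in> set vs" for x g
  proof -
    have "P x w * g w = (if w = r0 then g w else 0)
      + (if w = r x then if r x = r0 then 0 else g w else 0)
      + (if w = x then if r x = x then 0 else g w else 0)" if "w \<in> set vs" for w
      using r0 rr[OF x] that
      by (cases "r x = x"; cases "r x = r0"; cases "w = r0"; cases "w = x"; cases "w = r x";
          simp add: P_def)
    thus ?thesis
      using x rV[OF x] r0(1) by (simp add: sum.distrib)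
  qed
  have sum_L: "(\<Sum>w\<in>set vs. L x w * g w) =
      (n - p x) * g x - (\<Sum>w\<in>set vs. g w) + (\<Sum>w\<in>set vs. if r w = r x then g w else 0)"
    if x: "x \<in> set vs" for x g
  proof -
    have "L x w * g w = (if x = w then (n - p x) * g w else 0) - g w
      + (if r w = r x then g w else 0)" for w
      by (simp add: L_def algebra_simps)
    thus ?thesis using x by (simp add: sum.distrib sum_subtractf)
  qed
  have lap: "laplacian_matrix \<Gamma> vs = matrix_of L vs vs"
    unfolding laplacian_matrix_eq_matrix_of[OF assms(1-3)]
  proof (rule matrix_of_cong)
    fix x y assume x: "x \<in> set vs" and y: "y \<in> set vs"
    have "{w \<in> set vs. (x, w) \<in> parcs \<Gamma>} = set vs - {w \<in> set vs. r w = r x}"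
      using adj[OF x] by auto
    moreover have "card {w \<in> set vs. r w = r x} \<le> card (set vs)"
      by (intro card_mono) auto
    ultimately have "of_nat (card {w \<in> set vs. (x, w) \<in> parcs \<Gamma>}) = n - p x"
      by (simp add: card_Diff_subset n_def p_def len of_nat_diff)
    thus "(if x = y then of_nat (card {w \<in> set vs. (x, w) \<in> parcs \<Gamma>}) else 0)
      - (if (x, y) \<in> parcs \<Gamma> then 1 else 0) = L x y"
      using adj[OF x y] by (auto simp: L_def)
  qed
  have LP: "(\<Sum>w\<in>set vs. L x w * P w y) = (\<Sum>w\<in>set vs. P x w * B w y)"
    if x: "x \<in> set vs" and y: "y \<in> set vs" for x y
  proof -
    consider "y = r0" | "y \<noteq> r0" "r y = y" | "y \<noteq> r0" "r y \<noteq> y" by blast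
    thus ?thesis
    proof cases
      case 1
      hence "(\<Sum>w\<in>set vs. L x w * P w y) = 0"
        by (simp only: sum_L[OF x])
           (simp add: P_def sum_ind n_def p_def len cong: if_cong)
      thus ?thesis using 1 by (simp add: B_def)
    next
      case 2
      have "(\<Sum>w\<in>set vs. P w y) = p y"
        using 2 by (simp add: P_def sum_ind p_def)
      moreover have "(\<Sum>w\<in>set vs. if r w = r x then P w y else 0) = (if r x = y then p y else 0)"
      proof -
        have "(\<Sum>w\<in>set vs. if r w = r x then P w y else 0) =
            (\<Sum>w\<in>set vs. if r x = y \<and> r w = r y then 1 else 0)"
          using 2 by (intro sum.cong) (auto simp: P_def)
        thus ?thesis by (simp add: sum_ind p_def)
      qed
      moreover have "p x = p y" if "r x = y"
        using that 2 by (simp add: p_def)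
      ultimately have "(\<Sum>w\<in>set vs. L x w * P w y) = (if r x = y then n else 0) - p y"
        using 2 by (simp add: sum_L[OF x]) (simp add: P_def)
      thus ?thesis
        using 2 r0 rr[OF x] unfolding sum_P[OF x]
        by (cases "r x = x"; cases "r x = r0"; cases "x = r0"; cases "r x = y"; cases "x = y";
            simp add: B_def)
    next
      case 3
      have "(\<Sum>w\<in>set vs. P w y) = 1"
        using 3 y by (simp add: P_def)
      moreover have "(\<Sum>w\<in>set vs. if r w = r x then P w y else 0) = (if r x = r y then 1 else 0)"
      proof -
        have "(\<Sum>w\<in>set vs. if r w = r x then P w y else 0) =
            (\<Sum>w\<in>set vs. if w = y then if r x = r y then 1 else 0 else 0)"
          using 3 by (intro sum.cong) (auto simp: P_def)
        thus ?thesis using y by simp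
      qed
      ultimately have "(\<Sum>w\<in>set vs. L x w * P w y) =
          (if x = y then n - p y else 0) - 1 + (if r x = r y then 1 else 0)"
        using 3 by (simp add: sum_L[OF x]) (simp add: P_def)
      moreover have "x \<noteq> y" if "r x = x"
        using that 3 by auto
      moreover have "r x \<noteq> y" using rr[OF x] 3 by auto
      \<comment> \<open>By \<open>sum_P\<close> the right-hand side involves \<open>B\<close> only
        at \<open>r0\<close>, \<open>r x\<close> and \<open>x\<close>; these entries are now
        evaluated one by one.\<close>
      moreover have "B r0 y = (if r y = r0 then 0 else - 1)"
        using 3 r0 by (simp add: B_def)
      moreover have "B (r x) y = (if r y = r0 then - 1 else if r x = r y then 1 else 0)"
        if "r x \<noteq> r0"
        using that 3 rr[OF x] \<open>r x \<noteq> y\<close> by (simp add: B_def)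
      moreover have "B x y = (if x = y then n - p y else 0)" if "r x \<noteq> x"
      proof -
        have "x \<noteq> r0" "x \<noteq> r y" using that r0(2) rr[OF y] by auto
        thus ?thesis using that 3 by (simp add: B_def)
      qed
      ultimately show ?thesis
        unfolding sum_P[OF x] by (cases "r x = x"; cases "r x = r0"; simp)
    qed
  qed
  have "proots (char_poly (matrix_of L vs vs)) = image_mset (\<lambda>x. B x x) (mset vs)"
  proof (rule proots_char_poly_triangular[where P = P and rank = rank, OF \<open>distinct vs\<close> _ _ _ LP])
    show "P x x = 1" for x by (simp add: P_def)
    show "rank y < rank x" if "x \<in> set vs" "y \<in> set vs" "x \<noteq> y" "P x y \<noteq> 0" for x y
      using that r0 by (auto simp: P_def rank_def split: if_splits)
    show "rank x < rank y" if "x \<in> set vs" "y \<in> set vs" "x \<noteq> y" "B x y \<noteq> 0" for x y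
      using that r0 rr[OF that(2)]
      by (cases "x = r0"; cases "y = r0"; cases "r y = y"; cases "r y = r0"; cases "x = r y";
          cases "r x = x"; simp add: B_def rank_def)
  qed
  moreover have "B x x = (if x = r0 then 0 else if r x = x then of_nat (length vs)
      else of_nat (length vs) - of_nat (card {w \<in> set vs. r w = r x}))" for x
    by (simp add: B_def n_def p_def)
  ultimately show ?thesis
    by (simp only: laplacian_spectrum_def lap)
qed

section \<open>From representatives to the sizes of the parts\<close>

lemma image_mset_mset_set_partition_on:
  assumes "finite V" "partition_on V P"
  shows "image_mset f (mset_set V) = (\<Sum>C\<in>P. image_mset f (mset_set C))"
proof -
  have fin: "finite P" using assms by (rule finite_elements)
  have "image_mset f (mset_set (\<Union>Q)) = (\<Sum>C\<in>Q. image_mset f (mset_set C))"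
    if "finite Q" "Q \<subseteq> P" for Q
    using that
  proof (induction Q rule: finite_induct)
    case (insert C Q)
    have "finite (\<Union>Q)" "finite C"
      using insert.prems assms by (auto simp: partition_on_def intro: finite_subset)
    moreover have "C \<inter> D = {}" if "D \<in> Q" for D
      using that insert.prems insert.hyps disjointD[OF partition_onD2[OF assms(2)], of C D] by auto
    hence "C \<inter> \<Union>Q = {}" by blast
    ultimately show ?case
      using insert by (simp add: mset_set_Union)
  qed simp
  from this[OF fin] show ?thesis
    using assms(2) by (simp add: partition_on_def)
qed

lemma sum_replicate_mset: "(\<Sum>x\<in>A. replicate_mset k c) = replicate_mset (card A * k) c"
  by (induction A rule: infinite_finite_induct) (simp_all add: multiset_eq_iff)

text \<open>After choosing a representative in each part, one representative yields the eigenvalue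
  0, each other one the number of vertices, and each remaining vertex of a part \<open>C\<close> the
  number of vertices minus \<open>card C\<close>.\<close>

lemma laplacian_spectrum_complete_multipartite:
  fixes \<Gamma> :: "'a pair_pre_digraph"
  assumes "distinct vs" and V: "set vs = pverts \<Gamma>" "pverts \<Gamma> \<noteq> {}"
    and arcs: "parcs \<Gamma> \<subseteq> pverts \<Gamma> \<times> pverts \<Gamma>"
    and part: "partition_on (pverts \<Gamma>) P"
    and adj: "\<And>x y. \<lbrakk>x \<in> pverts \<Gamma>; y \<in> pverts \<Gamma>\<rbrakk> \<Longrightarrow>
      (x, y) \<in> parcs \<Gamma> \<longleftrightarrow> \<not> (\<exists>C\<in>P. x \<in> C \<and> y \<in> C)"
  shows "laplacian_spectrum \<Gamma> vs =
    {#0#} + replicate_mset (card P - 1) (of_nat (card (pverts \<Gamma>)))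
    + (\<Sum>C\<in>P. replicate_mset (card C - 1) (of_nat (card (pverts \<Gamma>)) - of_nat (card C)))"
proof -
  have finV: "finite (pverts \<Gamma>)" unfolding V(1)[symmetric] by simp
  have finP: "finite P" using finV part by (rule finite_elements)
  have UnP: "\<Union>P = pverts \<Gamma>" using part by (simp add: partition_on_def)
  \<comment> \<open>Any part will do: its representative plays the role of \<open>r0\<close> and
    carries the eigenvalue 0.\<close>
  obtain C0 where C0: "C0 \<in> P" using UnP V(2) by auto
  have uniq: "C = D" if "C \<in> P" "D \<in> P" "x \<in> C" "x \<in> D" for C D x
    using part that by (auto simp: partition_on_def pairwise_def disjnt_def)
  define \<rho> where "\<rho> C = (SOME x. x \<in> C)" for C :: "'a set"
  have \<rho>: "\<rho> C \<in> C" if "C \<in> P" for C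
    using part that unfolding \<rho>_def by (metis partition_on_def some_in_eq)
  define r where "r x = \<rho> (THE C. C \<in> P \<and> x \<in> C)" for x
  have r: "r x = \<rho> C" if "C \<in> P" "x \<in> C" for x C
  proof -
    have "(THE C. C \<in> P \<and> x \<in> C) = C"
      using that uniq by (intro the_equality) auto
    thus ?thesis by (simp add: r_def)
  qed
  have r_eq: "r x = r y \<longleftrightarrow> y \<in> C" if C: "C \<in> P" "x \<in> C" and y: "y \<in> pverts \<Gamma>" for x y C
  proof
    assume *: "r x = r y"
    obtain D where D: "D \<in> P" "y \<in> D" using y UnP by auto
    hence "\<rho> C = \<rho> D" using * r C by metis
    thus "y \<in> C" using uniq[OF C(1) D(1)] \<rho> D C(1) by metis
  qed (use C r in metis)
  have ex: "\<exists>C\<in>P. x \<in> C" if "x \<in> set vs" for x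
    using that UnP V(1) by auto
  define n :: complex where "n = of_nat (length vs)"
  have n: "n = of_nat (card (pverts \<Gamma>))"
    using distinct_card[OF \<open>distinct vs\<close>] V(1) by (simp add: n_def)
  define d where "d = (\<lambda>x. if x = \<rho> C0 then 0 else if r x = x then n
    else n - of_nat (card {w \<in> set vs. r w = r x}))"
  have "laplacian_spectrum \<Gamma> vs = image_mset d (mset vs)"
    unfolding d_def n_def
  proof (rule laplacian_spectrum_representatives)
    show "(x, y) \<in> parcs \<Gamma> \<longleftrightarrow> r x \<noteq> r y" if "x \<in> set vs" "y \<in> set vs" for x y
      using that adj[of x y] r_eq[of _ x y] ex[of x] by (auto simp: V(1))
    show "r x \<in> set vs" "r (r x) = r x" if "x \<in> set vs" for x
      using ex[OF that] r \<rho> UnP V(1) by (metis UnionI)+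
    show "\<rho> C0 \<in> set vs" "r (\<rho> C0) = \<rho> C0"
      using C0 r \<rho> UnP V(1) by (metis UnionI)+
  qed (use assms in auto)
  also have "mset vs = mset_set (pverts \<Gamma>)"
    using \<open>distinct vs\<close> V(1) by (metis mset_set_set)
  also have "image_mset d (mset_set (pverts \<Gamma>)) = (\<Sum>C\<in>P. image_mset d (mset_set C))"
    using finV part by (rule image_mset_mset_set_partition_on)
  also have "\<dots> = (\<Sum>C\<in>P. {#if C = C0 then 0 else n#}
      + replicate_mset (card C - 1) (n - of_nat (card C)))"
  proof (rule sum.cong[OF HOL.refl])
    fix C assume C: "C \<in> P"
    have finC: "finite C" using finV UnP C by (metis Sup_upper finite_subset)
    have "mset_set C = {#\<rho> C#} + mset_set (C - {\<rho> C})"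
      using \<rho>[OF C] finC by (simp add: mset_set.remove)
    moreover have "d (\<rho> C) = (if C = C0 then 0 else n)"
      using C C0 \<rho> uniq[OF C C0, of "\<rho> C"] r[OF C] by (auto simp: d_def)
    moreover have "d x = n - of_nat (card C)" if x: "x \<in> C - {\<rho> C}" for x
    proof -
      have "r w = r x \<longleftrightarrow> w \<in> C" if "w \<in> set vs" for w
        using r_eq[OF C, of x w] x that V(1) by auto
      hence "{w \<in> set vs. r w = r x} = C"
        using UnP C V(1) by blast
      moreover have "x \<noteq> \<rho> C0"
        using x uniq[OF C C0, of x] \<rho>[OF C0] by blast
      moreover have "r x \<noteq> x"
        using x r[OF C, of x] by auto
      ultimately show ?thesis by (simp add: d_def)
    qed
    hence "image_mset d (mset_set (C - {\<rho> C})) =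
        image_mset (\<lambda>_. n - of_nat (card C)) (mset_set (C - {\<rho> C}))"
      using finC by (intro image_mset_cong) simp
    hence "image_mset d (mset_set (C - {\<rho> C})) = replicate_mset (card C - 1) (n - of_nat (card C))"
      using finC \<rho>[OF C] by (simp add: image_mset_const_eq)
    ultimately show "image_mset d (mset_set C) =
        {#if C = C0 then 0 else n#} + replicate_mset (card C - 1) (n - of_nat (card C))"
      by simp
  qed
  also have "\<dots> = (\<Sum>C\<in>P. {#if C = C0 then 0 else n#})
      + (\<Sum>C\<in>P. replicate_mset (card C - 1) (n - of_nat (card C)))"
    by (rule sum.distrib)
  also have "(\<Sum>C\<in>P. {#if C = C0 then 0 else n#}) = {#0#} + (\<Sum>C\<in>P - {C0}. {#n#})"
    using finP C0 by (simp add: sum.remove[of P C0])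
  also have "(\<Sum>C\<in>P - {C0}. {#n#}) = replicate_mset (card P - 1) n"
    using sum_replicate_mset[of 1 n "P - {C0}"] finP C0 by simp
  finally show ?thesis by (simp add: n)
qed

section \<open>Groups covered by two cosets of an abelian subset\<close>

text \<open>Models the preimage \<open>A\<close> of the rotations and a lift \<open>b\<close> of a
  reflection. Asking for a set of commuting elements instead of a subgroup spares the closure proofs
  in the application.\<close>

locale abelian_two_cover = group G for G :: "('a, 'b) monoid_scheme" (structure) +
  fixes A :: "'a set" and b :: 'a
  assumes A_closed: "A \<subseteq> carrier G" and b_closed: "b \<in> carrier G"
    and A_comm: "\<lbrakk>u \<in> A; v \<in> A\<rbrakk> \<Longrightarrow> u \<otimes> v = v \<otimes> u"
    and cover: "carrier G = A \<union> (A #> b)"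
begin

text \<open>By \<open>cover\<close>, every group element is in \<open>A\<close> or of the form
  \<open>u \<otimes> b\<close> with \<open>u\<close> in \<open>A\<close>.\<close>

lemma center_if_commutes:
  assumes "c \<in> carrier G" "\<And>u. u \<in> A \<Longrightarrow> c \<otimes> u = u \<otimes> c" "c \<otimes> b = b \<otimes> c"
  shows "c \<in> center G"
  unfolding center_def
proof (intro CollectI conjI ballI)
  fix x assume "x \<in> carrier G"
  then consider "x \<in> A" | u where "u \<in> A" "x = u \<otimes> b"
    using cover by (auto simp: r_coset_def)
  thus "c \<otimes> x = x \<otimes> c"
  proof cases
    case 2
    thus ?thesis
      using assms A_closed b_closed by (metis m_assoc subsetD)
  qed (use assms in auto)
qed (fact assms)

text \<open>Write \<open>y = v \<otimes> b\<close> with \<open>v\<close> in \<open>A\<close>. Since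
  \<open>x\<close> commutes with \<open>v\<close> and with \<open>y\<close>, it commutes with
  \<open>b\<close>, and it commutes with \<open>A\<close> anyway.\<close>

lemma center_if_commutes_outside:
  assumes x: "x \<in> A" and y: "y \<in> carrier G" "y \<notin> A" and xy: "x \<otimes> y = y \<otimes> x"
  shows "x \<in> center G"
proof (rule center_if_commutes)
  show xG: "x \<in> carrier G" using x A_closed by auto
  obtain v where v: "v \<in> A" "y = v \<otimes> b"
    using y cover by (auto simp: r_coset_def)
  have vG: "v \<in> carrier G" using v A_closed by auto
  have "v \<otimes> (x \<otimes> b) = v \<otimes> (b \<otimes> x)"
    using xy A_comm[OF x v(1)] xG vG b_closed by (simp add: v(2) flip: m_assoc)
  thus "x \<otimes> b = b \<otimes> x" using xG vG b_closed by simp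
qed (use A_comm x in auto)

text \<open>With \<open>x = u \<otimes> b\<close> and \<open>y = v \<otimes> b\<close>, the quotient
  \<open>c\<close> of \<open>x\<close> by \<open>y\<close> equals \<open>u \<otimes> inv v\<close>.
  It commutes with \<open>A\<close> because \<open>u\<close> and \<open>v\<close> do, and with
  \<open>b\<close> because it commutes with \<open>v\<close> and \<open>y\<close>; so it is
  central.\<close>

lemma outside_commute_imp_same_coset:
  assumes x: "x \<in> carrier G" "x \<notin> A" and y: "y \<in> carrier G" "y \<notin> A"
    and xy: "x \<otimes> y = y \<otimes> x"
  shows "x \<in> center G #> y"
proof -
  obtain u where u: "u \<in> A" "x = u \<otimes> b" using x cover by (auto simp: r_coset_def)
  obtain v where v: "v \<in> A" "y = v \<otimes> b" using y cover by (auto simp: r_coset_def)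
  have uG: "u \<in> carrier G" and vG: "v \<in> carrier G" using u v A_closed by auto
  define c where "c = x \<otimes> inv y"
  have cG: "c \<in> carrier G" using x y by (simp add: c_def)
  have c: "c = u \<otimes> inv v"
    using uG vG b_closed
    by (simp add: c_def u v inv_mult_group m_assoc) (simp flip: m_assoc)
  \<comment> \<open>\<open>inv v\<close> is not known to lie in \<open>A\<close>, so the identity is
    checked after multiplying by \<open>v\<close> on the right and then cancelled.\<close>
  have cA: "c \<otimes> w = w \<otimes> c" if w: "w \<in> A" for w
  proof -
    have wG: "w \<in> carrier G" using w A_closed by auto
    have "(c \<otimes> w) \<otimes> v = u \<otimes> inv v \<otimes> (v \<otimes> w)"
      using cG wG vG A_comm[OF w v(1)] by (simp add: c m_assoc)
    also have "\<dots> = w \<otimes> u"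
      using uG vG wG A_comm[OF w u(1)] by (simp add: m_assoc inv_solve_left flip: m_assoc[of "inv v"])
    also have "\<dots> = (w \<otimes> c) \<otimes> v"
      using uG vG wG by (simp add: c m_assoc)
    finally show ?thesis using cG wG vG by simp
  qed
  \<comment> \<open>As \<open>x\<close> and \<open>y\<close> commute, both
    \<open>y \<otimes> c\<close> and \<open>c \<otimes> y\<close> equal \<open>x\<close>.\<close>
  have "y \<otimes> c = (x \<otimes> y) \<otimes> inv y"
    using x y unfolding xy by (simp add: c_def m_assoc)
  hence "c \<otimes> y = y \<otimes> c"
    using x y by (simp add: c_def m_assoc)
  hence "v \<otimes> (c \<otimes> b) = v \<otimes> (b \<otimes> c)"
    using cA[OF v(1)] cG vG b_closed by (simp add: v(2) flip: m_assoc)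
  hence "c \<otimes> b = b \<otimes> c" using cG vG b_closed by simp
  hence "c \<in> center G" using cG cA center_if_commutes by blast
  moreover have "x = c \<otimes> y" using x y by (simp add: c_def m_assoc)
  ultimately show ?thesis by (auto simp: r_coset_def)
qed

text \<open>The parts are \<open>A\<close> without the centre and the \<open>m\<close> central
  cosets outside \<open>A\<close>. Subtracting their sizes from the number
  \<open>(2 * m - 1) * card (center G)\<close> of vertices gives the two middle eigenvalues.\<close>

lemma laplacian_spectrum_non_commuting_graph:
  assumes fin: "finite (carrier G)" and m: "m \<ge> 2"
    and sat: "\<And>u. u \<in> A \<Longrightarrow> center G #> u \<subseteq> A"
    and ZA: "center G \<subseteq> A"
    and cardA: "card A = m * card (center G)" and cardG: "card (carrier G) = 2 * m * card (center G)"
    and vs: "distinct vs" "set vs = pverts (non_commuting_graph G)"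
  shows "laplacian_spectrum (non_commuting_graph G) vs =
    {#0#}
    + replicate_mset ((m - 1) * card (center G) - 1) (of_nat (m * card (center G)))
    + replicate_mset (m * card (center G) - m) (of_nat (2 * (m - 1) * card (center G)))
    + replicate_mset m (of_nat ((2 * m - 1) * card (center G)))"
proof -
  let ?Z = "center G" and ?\<Gamma> = "non_commuting_graph G"
  define z where "z = card ?Z"
  define R where "R = (\<lambda>x. ?Z #> x) ` (carrier G - A)"
  have Z: "subgroup ?Z G" using center_normal by (rule normal_imp_subgroup)
  have ZG: "?Z \<subseteq> carrier G" using Z by (rule subgroup.subset)
  have finZ: "finite ?Z" using ZG fin by (rule finite_subset)
  have finA: "finite A" using A_closed fin by (rule finite_subset)
  have zpos: "z > 0" using Z finZ subgroup.one_closed unfolding z_def by (auto simp: card_gt_0_iff)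
  have self: "x \<in> ?Z #> x" if "x \<in> carrier G" for x
    using that Z by (rule rcos_self)
  have verts: "pverts ?\<Gamma> = carrier G - ?Z" by (simp add: non_commuting_graph_def)
  have R_outside: "?Z #> x \<subseteq> carrier G - A" if x: "x \<in> carrier G - A" for x
  proof
    fix y assume y: "y \<in> ?Z #> x"
    have "y \<in> carrier G" using y x ZG r_coset_subset_G by blast
    \<comment> \<open>If \<open>y\<close> were in \<open>A\<close>, saturation would put its whole
      coset, which contains \<open>x\<close>, into \<open>A\<close>.\<close>
    moreover have "x \<in> A" if "y \<in> A"
      using repr_independence[OF y _ Z] x self[of x] sat[OF that] by auto
    ultimately show "y \<in> carrier G - A" using x by auto
  qed
  have UnR: "\<Union>R = carrier G - A"
    using R_outside self by (auto simp: R_def)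
  have R_rcosets: "R \<subseteq> rcosets ?Z" by (auto simp: R_def RCOSETS_def)
  have finR: "finite R" using fin by (simp add: R_def)
  have cardR': "card C = z" if "C \<in> R" for C
    using card_rcosets_equal[of C ?Z] that R_rcosets ZG by (auto simp: z_def)
  have disjR: "C \<inter> D = {}" if "C \<in> R" "D \<in> R" "C \<noteq> D" for C D
    using rcos_disjoint[OF Z] that R_rcosets by (auto simp: pairwise_def disjnt_def)
  \<comment> \<open>Cosets of size \<open>z\<close> partition the complement of \<open>A\<close>,
    which has \<open>m * z\<close> elements.\<close>
  have "z * card R = card (carrier G - A)"
    using card_partition[OF finR, of z] fin cardR' disjR by (simp add: UnR)
  also have "\<dots> = z * m"
    using cardA cardG finA A_closed by (simp add: card_Diff_subset z_def)
  finally have cardR: "card R = m" using zpos by simp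
  have cardAZ: "card (A - ?Z) = (m - 1) * z"
    using cardA ZA finZ by (simp add: card_Diff_subset z_def diff_mult_distrib)
  \<comment> \<open>With \<open>m \<ge> 2\<close> the set \<open>A - ?Z\<close> is nonempty, as a
    block of a partition must be.\<close>
  hence "card (A - ?Z) > 0" using m zpos by simp
  hence AZ_ne: "A - ?Z \<noteq> {}" by force
  have AZ_notin: "A - ?Z \<notin> R" using UnR AZ_ne by auto
  have part: "partition_on (pverts ?\<Gamma>) (insert (A - ?Z) R)"
  proof (rule partition_onI)
    show "\<Union>(insert (A - ?Z) R) = pverts ?\<Gamma>"
      using UnR ZA A_closed by (auto simp: verts)
    show "{} \<notin> insert (A - ?Z) R"
      using AZ_ne self by (auto simp: R_def)
    show "disjnt p q" if "p \<in> insert (A - ?Z) R" "q \<in> insert (A - ?Z) R" "p \<noteq> q" for p q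
      using that disjR UnR by (auto simp: disjnt_def)
  qed
  have adj: "(x, y) \<in> parcs ?\<Gamma> \<longleftrightarrow> \<not> (\<exists>C\<in>insert (A - ?Z) R. x \<in> C \<and> y \<in> C)"
    if "x \<in> pverts ?\<Gamma>" "y \<in> pverts ?\<Gamma>" for x y
  proof -
    have xy: "x \<in> carrier G" "x \<notin> ?Z" "y \<in> carrier G" "y \<notin> ?Z"
      using that by (auto simp: verts)
    have "x \<otimes> y = y \<otimes> x \<longleftrightarrow> (\<exists>C\<in>insert (A - ?Z) R. x \<in> C \<and> y \<in> C)"
    proof
      assume comm: "x \<otimes> y = y \<otimes> x"
      \<comment> \<open>In the mixed case the vertex inside \<open>A\<close> would be
        central.\<close>
      consider "x \<in> A" "y \<in> A" | "x \<notin> A" "y \<notin> A"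
        using center_if_commutes_outside[of x y] center_if_commutes_outside[of y x] comm xy by metis
      thus "\<exists>C\<in>insert (A - ?Z) R. x \<in> C \<and> y \<in> C"
      proof cases
        case 1
        thus ?thesis using xy by auto
      next
        case 2
        hence "x \<in> ?Z #> y" "y \<in> ?Z #> y" "?Z #> y \<in> R"
          using outside_commute_imp_same_coset comm xy self by (auto simp: R_def)
        thus ?thesis by blast
      qed
    next
      assume "\<exists>C\<in>insert (A - ?Z) R. x \<in> C \<and> y \<in> C"
      then consider "x \<in> A" "y \<in> A" | w where "w \<in> carrier G" "x \<in> ?Z #> w" "y \<in> ?Z #> w"
        by (auto simp: R_def)
      thus "x \<otimes> y = y \<otimes> x"
      proof cases
        case 1
        thus ?thesis by (rule A_comm)
      next
        case 2
        hence "x \<in> ?Z #> y" using repr_independence[OF _ _ Z] by metis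
        then obtain c where c: "c \<in> ?Z" "x = c \<otimes> y" by (auto simp: r_coset_def)
        have "c \<in> carrier G" "c \<otimes> y = y \<otimes> c"
          using c xy by (auto simp: center_def)
        thus ?thesis using xy by (simp add: c(2) m_assoc)
      qed
    qed
    thus ?thesis using xy by (auto simp: non_commuting_graph_def)
  qed
  have n: "card (pverts ?\<Gamma>) = 2 * m * z - z"
    using cardG ZG finZ by (simp add: verts card_Diff_subset z_def)
  \<comment> \<open>Writing \<open>m\<close> as \<open>k + 2\<close> removes the truncated
    subtractions before the eigenvalues are compared in the complex numbers.\<close>
  obtain k where k: "m = k + 2" using m by (metis add.commute le_Suc_ex)
  have "2 * m * z - z = (2 * m - 1) * z" by (simp add: diff_mult_distrib)
  hence ev: "complex_of_nat (2 * m * z - z) = of_nat ((2 * m - 1) * z)"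
    "complex_of_nat (2 * m * z - z) - of_nat ((m - 1) * z) = of_nat (m * z)"
    "complex_of_nat (2 * m * z - z) - of_nat z = of_nat (2 * (m - 1) * z)"
    by (simp_all add: k algebra_simps)
  have "laplacian_spectrum ?\<Gamma> vs =
    {#0#} + replicate_mset (card (insert (A - ?Z) R) - 1) (of_nat (card (pverts ?\<Gamma>)))
    + (\<Sum>C\<in>insert (A - ?Z) R.
        replicate_mset (card C - 1) (of_nat (card (pverts ?\<Gamma>)) - of_nat (card C)))"
  proof (rule laplacian_spectrum_complete_multipartite[OF vs _ _ part adj])
    show "pverts ?\<Gamma> \<noteq> {}" using AZ_ne A_closed by (auto simp: verts)
    show "parcs ?\<Gamma> \<subseteq> pverts ?\<Gamma> \<times> pverts ?\<Gamma>" by (auto simp: non_commuting_graph_def)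
  qed
  also have "(\<Sum>C\<in>insert (A - ?Z) R.
        replicate_mset (card C - 1) (complex_of_nat (card (pverts ?\<Gamma>)) - of_nat (card C))) =
      replicate_mset ((m - 1) * z - 1) (of_nat (m * z))
      + (\<Sum>C\<in>R. replicate_mset (z - 1) (of_nat (2 * (m - 1) * z)))"
    unfolding sum.insert[OF finR AZ_notin] n cardAZ ev(2)
    by (intro arg_cong2[where f = "(+)"] HOL.refl sum.cong) (simp only: cardR' ev(3))
  also have "(\<Sum>C\<in>R. replicate_mset (z - 1) (complex_of_nat (2 * (m - 1) * z))) =
      replicate_mset (m * z - m) (of_nat (2 * (m - 1) * z))"
    by (simp only: sum_replicate_mset cardR diff_mult_distrib2 mult_1_right)
  also have "card (insert (A - ?Z) R) - 1 = m"
    using finR AZ_notin cardR by simp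
  finally show ?thesis
    unfolding n ev by (simp only: z_def union_assoc union_commute union_lcomm)
qed

end

section \<open>The dihedral quotient\<close>

text \<open>\<alpha> and \<beta> are the classes of the two generators; the claim is the reduction
  of words to normal form, restated with group powers.\<close>

lemma dihedral_group_elements:
  assumes "m > 0"
  obtains \<alpha> \<beta> where "\<alpha> \<in> carrier (dihedral_group m)" "\<beta> \<in> carrier (dihedral_group m)"
    "\<And>x. x \<in> carrier (dihedral_group m) \<Longrightarrow> \<exists>k<m.
      x = \<alpha> [^]\<^bsub>dihedral_group m\<^esub> k \<or> x = \<alpha> [^]\<^bsub>dihedral_group m\<^esub> k \<otimes>\<^bsub>dihedral_group m\<^esub> \<beta>"
proof
  let ?D = "dihedral_group m" and ?cls = "\<lambda>w. word_rel (dihedral_relations m) `` {w}"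
  let ?\<alpha> = "?cls [(Gen_a, True)]" and ?\<beta> = "?cls [(Gen_b, True)]"
  show "?\<alpha> \<in> carrier ?D" "?\<beta> \<in> carrier ?D"
    by (auto simp: dihedral_group_def carrier_presented_group)
  have pow: "?\<alpha> [^]\<^bsub>?D\<^esub> k = ?cls (replicate k (Gen_a, True))" for k :: nat
  proof (induction k)
    case 0
    show ?case by (simp add: dihedral_group_def presented_group_def nat_pow_def)
  next
    case (Suc k)
    interpret D: group ?D by (rule group_dihedral_group)
    show ?case
      using Suc by (simp add: dihedral_group_def mult_presented_group flip: replicate_append_same)
  qed
  fix x assume "x \<in> carrier ?D"
  then obtain w where w: "x = ?cls w" by (auto simp: dihedral_group_def carrier_presented_group)
  obtain k s where k: "k < m" and "word_eq (dihedral_relations m) w (dihedral_nf (k, s))"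
    using dihedral_word_eq_nf[OF assms] by blast
  hence "x = ?cls (dihedral_nf (k, s))" by (simp add: w word_class_eq_iff)
  hence "x = ?\<alpha> [^]\<^bsub>?D\<^esub> k \<or> x = ?\<alpha> [^]\<^bsub>?D\<^esub> k \<otimes>\<^bsub>?D\<^esub> ?\<beta>"
    unfolding pow by (cases s) (simp_all add: dihedral_nf_def dihedral_group_def mult_presented_group)
  thus "\<exists>k<m. x = ?\<alpha> [^]\<^bsub>?D\<^esub> k \<or> x = ?\<alpha> [^]\<^bsub>?D\<^esub> k \<otimes>\<^bsub>?D\<^esub> ?\<beta>"
    using k by blast
qed

section \<open>Lifting the dihedral structure from the central quotient to the group\<close>

theorem theorem3p4:
  fixes G :: "('a, 'b) monoid_scheme" and m :: nat and vs :: "'a list"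
  assumes "m \<ge> 2"
    and "group G" and "finite (carrier G)"
    and "G Mod center G \<cong> dihedral_group m"
    and "distinct vs" and "set vs = pverts (non_commuting_graph G)"
  shows "laplacian_spectrum (non_commuting_graph G) vs =
    {#0#}
    + replicate_mset ((m - 1) * card (center G) - 1) (of_nat (m * card (center G)))
    + replicate_mset (m * card (center G) - m) (of_nat (2 * (m - 1) * card (center G)))
    + replicate_mset m (of_nat ((2 * m - 1) * card (center G)))"
proof -
  let ?Z = "center G" and ?D = "dihedral_group m"
  interpret group G by fact
  interpret Z: normal ?Z G by (rule center_normal)
  interpret Q: group "G Mod ?Z" by (rule Z.factorgroup_is_group)
  interpret D: group ?D by (rule group_dihedral_group)
  have Z: "subgroup ?Z G" by (rule Z.subgroup_axioms)
  \<comment> \<open>The isomorphism is inverted so that powers of \<alpha> and products with \<beta>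
    can be carried over to cosets of the centre.\<close>
  obtain \<phi> where \<phi>: "\<phi> \<in> iso ?D (G Mod ?Z)"
    using Q.iso_sym[OF assms(4)] by (auto simp: is_iso_def)
  interpret \<phi>: group_hom ?D "G Mod ?Z" \<phi>
    using \<phi> by unfold_locales (simp add: iso_def)
  have surj: "\<phi> ` carrier ?D = carrier (G Mod ?Z)"
    using \<phi> by (auto simp: iso_def bij_betw_def)
  obtain \<alpha> \<beta> where \<alpha>: "\<alpha> \<in> carrier ?D" and \<beta>: "\<beta> \<in> carrier ?D"
    and D: "\<And>x. x \<in> carrier ?D \<Longrightarrow>
      \<exists>k<m. x = \<alpha> [^]\<^bsub>?D\<^esub> k \<or> x = \<alpha> [^]\<^bsub>?D\<^esub> k \<otimes>\<^bsub>?D\<^esub> \<beta>"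
    using dihedral_group_elements[of m] assms(1) by auto
  obtain a where a: "a \<in> carrier G" "\<phi> \<alpha> = ?Z #>\<^bsub>G\<^esub> a"
    using \<phi>.hom_closed[OF \<alpha>] by (auto simp: carrier_FactGroup)
  obtain b where b: "b \<in> carrier G" "\<phi> \<beta> = ?Z #>\<^bsub>G\<^esub> b"
    using \<phi>.hom_closed[OF \<beta>] by (auto simp: carrier_FactGroup)
  have \<phi>_pow: "\<phi> (\<alpha> [^]\<^bsub>?D\<^esub> k) = ?Z #>\<^bsub>G\<^esub> a [^]\<^bsub>G\<^esub> k" for k :: nat
    using \<phi>.hom_nat_pow[OF \<alpha>] a Z.FactGroup_pow by simp
  \<comment> \<open>The preimage of the rotation subgroup, as the union of the cosets that
    correspond to the powers of \<alpha>.\<close>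
  define A where "A = (\<Union>k<m. ?Z #>\<^bsub>G\<^esub> a [^]\<^bsub>G\<^esub> k)"
  have AG: "A \<subseteq> carrier G"
    using a Z.subset r_coset_subset_G unfolding A_def by blast
  have Zc: "c \<otimes>\<^bsub>G\<^esub> x = x \<otimes>\<^bsub>G\<^esub> c" if "c \<in> ?Z" "x \<in> carrier G" for c x
    using that unfolding center_def by blast
  have cover: "x \<in> A \<union> (A #>\<^bsub>G\<^esub> b)" if x: "x \<in> carrier G" for x
  proof -
    have "?Z #>\<^bsub>G\<^esub> x \<in> \<phi> ` carrier ?D"
      using x by (auto simp: surj carrier_FactGroup)
    then obtain d where d: "d \<in> carrier ?D" "?Z #>\<^bsub>G\<^esub> x = \<phi> d" by blast
    obtain k where k: "k < m"
      and "d = \<alpha> [^]\<^bsub>?D\<^esub> k \<or> d = \<alpha> [^]\<^bsub>?D\<^esub> k \<otimes>\<^bsub>?D\<^esub> \<beta>"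
      using D[OF d(1)] by blast
    moreover have "\<phi> (\<alpha> [^]\<^bsub>?D\<^esub> k \<otimes>\<^bsub>?D\<^esub> \<beta>) = ?Z #>\<^bsub>G\<^esub> (a [^]\<^bsub>G\<^esub> k \<otimes>\<^bsub>G\<^esub> b)"
      using \<alpha> \<beta> a b by (simp add: \<phi>_pow Z.rcos_sum)
    ultimately have kx: "?Z #>\<^bsub>G\<^esub> x = ?Z #>\<^bsub>G\<^esub> a [^]\<^bsub>G\<^esub> k
        \<or> ?Z #>\<^bsub>G\<^esub> x = ?Z #>\<^bsub>G\<^esub> (a [^]\<^bsub>G\<^esub> k \<otimes>\<^bsub>G\<^esub> b)"
      using d(2) \<phi>_pow by auto
    have "x \<in> ?Z #>\<^bsub>G\<^esub> x" using x Z by (rule rcos_self)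
    moreover have "?Z #>\<^bsub>G\<^esub> (a [^]\<^bsub>G\<^esub> k \<otimes>\<^bsub>G\<^esub> b) = (?Z #>\<^bsub>G\<^esub> a [^]\<^bsub>G\<^esub> k) #>\<^bsub>G\<^esub> b"
      using a b Z.subset by (simp add: coset_mult_assoc)
    moreover have "?Z #>\<^bsub>G\<^esub> a [^]\<^bsub>G\<^esub> k \<subseteq> A" using k by (auto simp: A_def)
    moreover from this have "(?Z #>\<^bsub>G\<^esub> a [^]\<^bsub>G\<^esub> k) #>\<^bsub>G\<^esub> b \<subseteq> A #>\<^bsub>G\<^esub> b"
      by (auto simp: r_coset_def)
    ultimately show ?thesis using kx by blast
  qed
  interpret abelian_two_cover G A b
  proof
    show "A \<subseteq> carrier G" "b \<in> carrier G" by fact+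
    show "carrier G = A \<union> (A #>\<^bsub>G\<^esub> b)"
      using cover AG b r_coset_subset_G by blast
    fix u v assume "u \<in> A" "v \<in> A"
    then obtain c k d l where u: "c \<in> ?Z" "u = c \<otimes>\<^bsub>G\<^esub> a [^]\<^bsub>G\<^esub> (k :: nat)"
      and v: "d \<in> ?Z" "v = d \<otimes>\<^bsub>G\<^esub> a [^]\<^bsub>G\<^esub> (l :: nat)"
      by (auto simp: A_def r_coset_def)
    have cl: "c \<in> carrier G" "d \<in> carrier G" "a [^]\<^bsub>G\<^esub> k \<in> carrier G" "a [^]\<^bsub>G\<^esub> l \<in> carrier G"
      using u v a Z.subset by auto
    \<comment> \<open>Central factors can be collected in front, which leaves two powers of
      \<open>a\<close>, and these commute.\<close>
    have swap: "(c \<otimes>\<^bsub>G\<^esub> p) \<otimes>\<^bsub>G\<^esub> (d \<otimes>\<^bsub>G\<^esub> q) = (c \<otimes>\<^bsub>G\<^esub> d) \<otimes>\<^bsub>G\<^esub> (p \<otimes>\<^bsub>G\<^esub> q)"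
      if "c \<in> ?Z" "d \<in> ?Z" "p \<in> carrier G" "q \<in> carrier G" for c d p q
    proof -
      have "c \<in> carrier G" "d \<in> carrier G" using that Z.subset by auto
      hence "(c \<otimes>\<^bsub>G\<^esub> p) \<otimes>\<^bsub>G\<^esub> (d \<otimes>\<^bsub>G\<^esub> q) = c \<otimes>\<^bsub>G\<^esub> ((p \<otimes>\<^bsub>G\<^esub> d) \<otimes>\<^bsub>G\<^esub> q)"
        "(c \<otimes>\<^bsub>G\<^esub> d) \<otimes>\<^bsub>G\<^esub> (p \<otimes>\<^bsub>G\<^esub> q) = c \<otimes>\<^bsub>G\<^esub> ((d \<otimes>\<^bsub>G\<^esub> p) \<otimes>\<^bsub>G\<^esub> q)"
        using that by (simp_all add: m_assoc)
      thus ?thesis using Zc[OF that(2,3)] by simp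
    qed
    have "u \<otimes>\<^bsub>G\<^esub> v = (c \<otimes>\<^bsub>G\<^esub> d) \<otimes>\<^bsub>G\<^esub> (a [^]\<^bsub>G\<^esub> k \<otimes>\<^bsub>G\<^esub> a [^]\<^bsub>G\<^esub> l)"
      unfolding u v using u v cl by (intro swap) auto
    also have "\<dots> = (d \<otimes>\<^bsub>G\<^esub> c) \<otimes>\<^bsub>G\<^esub> (a [^]\<^bsub>G\<^esub> l \<otimes>\<^bsub>G\<^esub> a [^]\<^bsub>G\<^esub> k)"
      unfolding Zc[OF u(1) cl(2)] using a by (simp add: nat_pow_mult add.commute)
    also have "\<dots> = v \<otimes>\<^bsub>G\<^esub> u"
      unfolding u v using u v cl by (intro swap[symmetric]) auto
    finally show "u \<otimes>\<^bsub>G\<^esub> v = v \<otimes>\<^bsub>G\<^esub> u" .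
  qed
  have cosets: "card (?Z #>\<^bsub>G\<^esub> a [^]\<^bsub>G\<^esub> k) = card ?Z" for k :: nat
    using card_rcosets_equal[OF rcosetsI[OF Z.subset nat_pow_closed[OF a(1)]] Z.subset] by simp
  have cardG: "card (carrier G) = 2 * m * card ?Z"
  proof -
    have "card (rcosets\<^bsub>G\<^esub> ?Z) = 2 * m"
      using iso_same_card[OF assms(4)] order_dihedral_group[of m] assms(1)
      by (simp add: Coset.order_def FactGroup_def)
    thus ?thesis using lagrange[OF Z] by (simp add: Coset.order_def)
  qed
  \<comment> \<open>The upper bound counts \<open>m\<close> cosets. For the lower bound,
    \<open>A\<close> and a translate of the same size cover the group, whose order is
    \<open>2 * m * card ?Z\<close>. This replaces a proof that the cosets are distinct.\<close>
  have cardA: "card A = m * card ?Z"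
  proof (rule antisym)
    show "card A \<le> m * card ?Z"
      using card_UN_le[of "{..<m}" "\<lambda>k. ?Z #>\<^bsub>G\<^esub> a [^]\<^bsub>G\<^esub> k"] by (simp add: A_def cosets)
    have "card (carrier G) \<le> card A + card (A #>\<^bsub>G\<^esub> b)"
      unfolding abelian_two_cover.cover[OF abelian_two_cover_axioms] by (rule card_Un_le)
    also have "card (A #>\<^bsub>G\<^esub> b) = card A"
      using card_rcosets_equal[OF rcosetsI[OF AG b(1)] AG] by simp
    finally show "m * card ?Z \<le> card A" by (simp add: cardG)
  qed
  show ?thesis
  proof (rule laplacian_spectrum_non_commuting_graph)
    have "?Z = ?Z #>\<^bsub>G\<^esub> a [^]\<^bsub>G\<^esub> (0 :: nat)" using Z.subset by (simp add: coset_mult_one)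
    thus "?Z \<subseteq> A" using assms(1) UN_upper[of 0 "{..<m}" "\<lambda>k. ?Z #>\<^bsub>G\<^esub> a [^]\<^bsub>G\<^esub> k"]
      by (simp add: A_def)
    show "?Z #>\<^bsub>G\<^esub> u \<subseteq> A" if u: "u \<in> A" for u
    proof -
      obtain k where "k < m" "u \<in> ?Z #>\<^bsub>G\<^esub> a [^]\<^bsub>G\<^esub> k" using u by (auto simp: A_def)
      moreover from this have "?Z #>\<^bsub>G\<^esub> u = ?Z #>\<^bsub>G\<^esub> a [^]\<^bsub>G\<^esub> k"
        using repr_independence[OF _ _ Z] a by (metis nat_pow_closed)
      ultimately show ?thesis by (auto simp: A_def)
    qed
  qed (use assms cardA cardG in auto)
qed

end
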